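(* Let $d\ge 3$ and let $P$ be a simplicial $d$-polytope with graph $G(P)$. Then every minimum edge cut of $G(P)$ of cardinality at most $4d-7$ is trivial, i.e. it consists of all the edges incident with some single vertex of $G(P)$.
   Context: A (convex) polytope is the convex hull of a finite set of points in a Euclidean space; a $d$-polytope is a polytope of dimension $d$. A facet of a $d$-polytope is a face of dimension $d-1$. A polytope is simplicial if all its facets are (combinatorially isomorphic to) simplices. The graph $G(P)$ of a polytope $P$ is the finite simple graph whose vertices and edges are the vertices ($0$-dimensional faces) and edges ($1$-dimensional faces) of $P$. For a connected graph $G$ with vertex set $V(G)$, an edge cut is a set of edges of the form $E(X,V(G)\setminus X)$ for some nonempty proper subset $X\subset V(G)$, where $E(X,V(G)\setminus X)$ is the set of all edges with one end in $X$ and the other in $V(G)\setminus X$. A minimum edge cut of $G$ is an edge cut of smallest cardinality among all edge cuts of $G$. An edge cut is trivial if it is exactly the set of all edges incident with a single vertex of $G$; otherwise it is nontrivial. *)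

theory Defs
  imports "HOL-Analysis.Analysis"
begin

subsection \<open>Edge cuts in finite simple graphs\<close>

text \<open>A simple graph is a pair of a vertex set and a set of two-element sets of vertices.\<close>

type_synonym 'v sgraph = "'v set \<times> 'v set set"

abbreviation verts :: "'v sgraph \<Rightarrow> 'v set" where
  "verts G \<equiv> fst G"

abbreviation edges :: "'v sgraph \<Rightarrow> 'v set set" where
  "edges G \<equiv> snd G"

definition simple_graph :: "'v sgraph \<Rightarrow> bool" where
  "simple_graph G \<longleftrightarrow> finite (verts G) \<and> (\<forall>e\<in>edges G. e \<subseteq> verts G \<and> card e = 2)"

definition edges_between :: "'v sgraph \<Rightarrow> 'v set \<Rightarrow> 'v set \<Rightarrow> 'v set set" where
  "edges_between G X Y = {e \<in> edges G. \<exists>x\<in>X. \<exists>y\<in>Y. e = {x, y}}"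

definition edge_cut :: "'v sgraph \<Rightarrow> 'v set set \<Rightarrow> bool" where
  "edge_cut G C \<longleftrightarrow> (\<exists>X. X \<noteq> {} \<and> X \<subset> verts G \<and> C = edges_between G X (verts G - X))"

text \<open>Comparing cardinalities with \<open>card\<close> is only meaningful for finite edge sets, as is the
  case for \<open>simple_graph\<close>.\<close>

definition minimum_edge_cut :: "'v sgraph \<Rightarrow> 'v set set \<Rightarrow> bool" where
  "minimum_edge_cut G C \<longleftrightarrow> edge_cut G C \<and> (\<forall>D. edge_cut G D \<longrightarrow> card C \<le> card D)"

definition trivial_edge_cut :: "'v sgraph \<Rightarrow> 'v set set \<Rightarrow> bool" where
  "trivial_edge_cut G C \<longleftrightarrow> edge_cut G C \<and> (\<exists>v\<in>verts G. C = {e \<in> edges G. v \<in> e})"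

subsection \<open>Simplicial polytopes and graphs of polytopes\<close>

text \<open>Isomorphism of the face lattices; with \<open>face_of\<close> both the empty set and the polytope
  itself count as faces.\<close>

definition combinatorially_isomorphic ::
    "'a::euclidean_space set \<Rightarrow> 'b::euclidean_space set \<Rightarrow> bool" where
  "combinatorially_isomorphic P Q \<longleftrightarrow>
     (\<exists>f. bij_betw f {F. F face_of P} {F. F face_of Q} \<and>
          (\<forall>F G. F face_of P \<longrightarrow> G face_of P \<longrightarrow> (F \<subseteq> G \<longleftrightarrow> f F \<subseteq> f G)))"

text \<open>The simplex may be taken in the ambient space of \<open>P\<close>: a simplex combinatorially
  isomorphic to a facet has the dimension of the facet.\<close>

definition simplicial_polytope :: "'a::euclidean_space set \<Rightarrow> bool" where
  "simplicial_polytope P \<longleftrightarrow>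
     polytope P \<and>
     (\<forall>F. F facet_of P \<longrightarrow>
        (\<exists>(S::'a set) n. n simplex S \<and> combinatorially_isomorphic F S))"

definition polytope_vertices :: "'a::euclidean_space set \<Rightarrow> 'a set" where
  "polytope_vertices P = {v. {v} face_of P}"

text \<open>A one-dimensional face is recorded in the graph as the set of the vertices it contains.\<close>

definition polytope_graph :: "'a::euclidean_space set \<Rightarrow> 'a sgraph" where
  "polytope_graph P =
     (polytope_vertices P, {e \<inter> polytope_vertices P | e. e edge_of P})"

lemma simple_graph_finite_edges: "simple_graph G \<Longrightarrow> finite (edges G)"
  unfolding simple_graph_def by (meson PowI finite_Pow_iff finite_subset subsetI)

lemma simple_graph_polytope_graph:
  assumes "polytope P"
  shows "simple_graph (polytope_graph P)"
proof -
  have vert: "v \<in> polytope_vertices P \<longleftrightarrow> v extreme_point_of P" for v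
    by (simp add: polytope_vertices_def face_of_singleton)
  have fin: "finite (polytope_vertices P)"
    using finite_polyhedron_extreme_points[OF polytope_imp_polyhedron[OF assms]] vert
    by (metis (no_types, lifting) Collect_cong Collect_mem_eq)
  have "card (e \<inter> polytope_vertices P) = 2" if e: "e edge_of P" for e
  proof -
    have f: "e face_of P" and d: "aff_dim e = 1" using e by (auto simp: edge_of_def)
    have pe: "polytope e" using f assms face_of_polytope_polytope by blast
    have "compact e" "convex e" "collinear e" "e \<noteq> {}"
      using pe d by (auto simp: polytope_imp_compact polytope_imp_convex collinear_aff_dim)
    then obtain a b where ab: "e = closed_segment a b"
      using compact_convex_collinear_segment by blast
    have "a \<noteq> b" using d ab by auto
    have "e \<inter> polytope_vertices P = {v. v extreme_point_of e}"
      using extreme_point_of_face[OF f] vert by auto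
    also have "\<dots> = {a, b}" using ab by (auto simp: extreme_point_of_segment)
    finally show ?thesis using \<open>a \<noteq> b\<close> by simp
  qed
  then show ?thesis using fin by (auto simp: simple_graph_def polytope_graph_def)
qed

end

theory Submission
  imports Defs
begin

text \<open>Suppose a minimum cut \<open>C\<close> is nontrivial. The ends of an edge of \<open>P\<close> have at least \<open>d - 1\<close> common
  neighbours: a facet through the edge has \<open>d\<close> pairwise adjacent vertices, and a second facet through
  it contributes one more. Each common neighbour of the ends of a cut edge yields another cut edge at
  one of them, so the degrees of these ends within \<open>C\<close> add up to at least \<open>d + 1\<close>. Consequently \<open>C\<close>
  has at least \<open>d\<close> edges, and, all degrees of the graph being at least \<open>|C|\<close>, both sides of the cut
  have at least \<open>d\<close> vertices. By Balinski's theorem fewer than \<open>d\<close> vertices cannot cover \<open>C\<close>, so by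
  Koenig's theorem \<open>C\<close> contains a matching with \<open>d\<close> edges. Adding up the degrees of its ends counts
  each edge of \<open>C\<close> at most twice, whence \<open>d (d + 1) \<le> 2 |C|\<close>, which is incompatible with
  \<open>|C| \<le> 4 d - 7\<close>.\<close>

section \<open>Koenig's theorem and degree sums\<close>

text \<open>Among the subsets of \<open>E\<close> that cannot be covered by fewer than
  \<open>m\<close> vertices, take one of least cardinality. Minimality makes it a matching, and the
  left ends of a matching cover it, so it has at least \<open>m\<close> edges.\<close>

lemma konig_matching:
  fixes E :: "('a \<times> 'b) set"
  assumes "finite E"
    and "\<And>S T. \<lbrakk>finite S; finite T; E \<subseteq> S \<times> UNIV \<union> UNIV \<times> T\<rbrakk> \<Longrightarrow> m \<le> card S + card T"
  obtains M where "M \<subseteq> E" "inj_on fst M" "inj_on snd M" "m \<le> card M"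
proof -
  define cov where "cov F S T \<longleftrightarrow> finite S \<and> finite T \<and> F \<subseteq> S \<times> UNIV \<union> UNIV \<times> T"
    for F :: "('a \<times> 'b) set" and S T
  define big where "big F \<longleftrightarrow> F \<subseteq> E \<and> (\<forall>S T. cov F S T \<longrightarrow> m \<le> card S + card T)" for F
  have "big E" using assms(2) by (auto simp: big_def cov_def)
  then obtain M where M: "big M" and min: "\<And>F. big F \<Longrightarrow> card M \<le> card F"
    using ex_has_least_nat[of big E card] by (auto simp: not_le)
  have ME: "M \<subseteq> E" and finM: "finite M" using M assms(1) by (auto simp: big_def finite_subset)
  have coverD: "m \<le> card S + card T" if "cov M S T" for S T using M that by (simp add: big_def)
  have cover_del: "\<exists>S T. cov (M - {e}) S T \<and> card S + card T < m" if "e \<in> M" for e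
  proof -
    have "\<not> big (M - {e})" using min[of "M - {e}"] card_Diff1_less[OF finM that] by linarith
    then show ?thesis using ME by (auto simp: big_def not_le)
  qed
  \<comment> \<open>Uncrossing covers of \<open>M\<close> minus either of two adjacent edges gives one cover of \<open>M\<close> and another
    that needs only the common end added; together they are too small.\<close>
  have "y1 = y2" if e: "(x, y1) \<in> M" "(x, y2) \<in> M" for x y1 y2
  proof (rule ccontr)
    assume ne: "y1 \<noteq> y2"
    obtain S1 T1 where c1: "cov (M - {(x, y1)}) S1 T1" "card S1 + card T1 < m"
      using cover_del e by blast
    obtain S2 T2 where c2: "cov (M - {(x, y2)}) S2 T2" "card S2 + card T2 < m"
      using cover_del e by blast
    have fin: "finite S1" "finite S2" "finite T1" "finite T2" using c1 c2 by (auto simp: cov_def)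
    have "\<not> cov M S1 T1" "\<not> cov M S2 T2" using coverD[of S1 T1] coverD[of S2 T2] c1 c2 by auto
    then have x: "x \<notin> S1" "x \<notin> S2" using c1 c2 by (auto simp: cov_def)
    have "cov M (insert x (S1 \<union> S2)) (T1 \<inter> T2)"
      using c1 c2 by (auto simp: cov_def)
    then have 1: "m \<le> Suc (card (S1 \<union> S2)) + card (T1 \<inter> T2)"
      using coverD x fin by fastforce
    \<comment> \<open>The second cover misses only \<open>(x, y2)\<close>, so it covers
      \<open>(x, y1)\<close>, and not through \<open>x\<close>; likewise for the first.\<close>
    have "y1 \<in> T2" "y2 \<in> T1" using c1 c2 e x ne by (auto simp: cov_def)
    then have "cov M (S1 \<inter> S2) (T1 \<union> T2)"
      using c1 c2 by (auto simp: cov_def)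
    then have 2: "m \<le> card (S1 \<inter> S2) + card (T1 \<union> T2)"
      by (rule coverD)
    show False
      using 1 2 c1(2) c2(2) card_Un_Int[OF fin(1,2)] card_Un_Int[OF fin(3,4)] by linarith
  qed
  then have inj1: "inj_on fst M" by (auto simp: inj_on_def)
  have "x1 = x2" if e: "(x1, y) \<in> M" "(x2, y) \<in> M" for x1 x2 y
  proof (rule ccontr)
    assume ne: "x1 \<noteq> x2"
    obtain S1 T1 where c1: "cov (M - {(x1, y)}) S1 T1" "card S1 + card T1 < m"
      using cover_del e by blast
    obtain S2 T2 where c2: "cov (M - {(x2, y)}) S2 T2" "card S2 + card T2 < m"
      using cover_del e by blast
    have fin: "finite S1" "finite S2" "finite T1" "finite T2" using c1 c2 by (auto simp: cov_def)
    have "\<not> cov M S1 T1" "\<not> cov M S2 T2" using coverD[of S1 T1] coverD[of S2 T2] c1 c2 by auto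
    then have y: "y \<notin> T1" "y \<notin> T2" using c1 c2 by (auto simp: cov_def)
    have "cov M (S1 \<inter> S2) (insert y (T1 \<union> T2))"
      using c1 c2 by (auto simp: cov_def)
    then have 1: "m \<le> card (S1 \<inter> S2) + Suc (card (T1 \<union> T2))"
      using coverD y fin by fastforce
    have "x1 \<in> S2" "x2 \<in> S1" using c1 c2 e y ne by (auto simp: cov_def)
    then have "cov M (S1 \<union> S2) (T1 \<inter> T2)"
      using c1 c2 by (auto simp: cov_def)
    then have 2: "m \<le> card (S1 \<union> S2) + card (T1 \<inter> T2)"
      by (rule coverD)
    show False
      using 1 2 c1(2) c2(2) card_Un_Int[OF fin(1,2)] card_Un_Int[OF fin(3,4)] by linarith
  qed
  then have inj2: "inj_on snd M" by (auto simp: inj_on_def)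
  have "cov M (fst ` M) {}" using finM by (force simp: cov_def)
  then have "m \<le> card M" using coverD card_image[OF inj1] by fastforce
  with that ME inj1 inj2 show thesis by blast
qed

lemma card_eq_sum_fibres_fst:
  assumes "finite E" "finite X" "fst ` E \<subseteq> X"
  shows "card E = (\<Sum>x\<in>X. card {y. (x, y) \<in> E})"
proof -
  have "finite {y. (x, y) \<in> E}" for x
    by (rule finite_subset[of _ "snd ` E"]) (use assms(1) in force)+
  then have "(\<Sum>x\<in>X. card {y. (x, y) \<in> E}) = card (SIGMA x:X. {y. (x, y) \<in> E})"
    using assms(2) by simp
  moreover have "(SIGMA x:X. {y. (x, y) \<in> E}) = E" using assms(3) by force
  ultimately show ?thesis by simp
qed

lemma sum_fibres_le_card:
  assumes "finite E" "finite X"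
  shows "(\<Sum>x\<in>X. card {y. (x, y) \<in> E}) \<le> card E"
proof -
  let ?E = "{e \<in> E. fst e \<in> X}"
  have "(\<Sum>x\<in>X. card {y. (x, y) \<in> E}) = (\<Sum>x\<in>X. card {y. (x, y) \<in> ?E})"
    by (rule sum.cong) auto
  also have "\<dots> = card ?E"
    by (rule card_eq_sum_fibres_fst[symmetric]) (use assms in auto)
  also have "\<dots> \<le> card E" using assms by (auto intro: card_mono)
  finally show ?thesis .
qed

text \<open>Sum \<open>deg\<close> over a matching with at least \<open>m\<close> edges. Its left
  ends are distinct, and so are its right ends, so either half of the sum counts an edge of
  \<open>E\<close> at most once.\<close>

lemma card_ge_of_cover_and_degree_sum:
  fixes E :: "('a \<times> 'b) set"
  assumes fin: "finite E"
    and cover: "\<And>S T. \<lbrakk>finite S; finite T; E \<subseteq> S \<times> UNIV \<union> UNIV \<times> T\<rbrakk> \<Longrightarrow> m \<le> card S + card T"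
    and deg: "\<And>x y. (x, y) \<in> E \<Longrightarrow> s \<le> card {y'. (x, y') \<in> E} + card {x'. (x', y) \<in> E}"
  shows "m * s \<le> 2 * card E"
proof -
  obtain M where M: "M \<subseteq> E" "inj_on fst M" "inj_on snd M" "m \<le> card M"
    using konig_matching[OF fin cover] by blast
  have finM: "finite M" using M fin finite_subset by blast
  let ?l = "\<lambda>x. card {y. (x, y) \<in> E}" and ?r = "\<lambda>y. card {x. (x, y) \<in> E}"
  have "m * s \<le> card M * s" using M by simp
  also have "\<dots> = (\<Sum>e\<in>M. s)" by simp
  also have "\<dots> \<le> (\<Sum>e\<in>M. ?l (fst e) + ?r (snd e))"
    using M deg by (intro sum_mono) (metis prod.collapse subsetD)
  also have "\<dots> = (\<Sum>x\<in>fst ` M. ?l x) + (\<Sum>y\<in>snd ` M. ?r y)"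
    using M by (simp add: sum.distrib sum.reindex)
  also have "\<dots> \<le> card E + card (E\<inverse>)"
    using sum_fibres_le_card[OF fin, of "fst ` M"] sum_fibres_le_card[of "E\<inverse>" "snd ` M"] fin finM
    by (intro add_mono) auto
  finally show ?thesis by simp
qed

section \<open>Vertices and edges of polytopes\<close>

lemma polytope_eq_convex_hull_vertices:
  assumes "polytope P"
  shows "P = convex hull (polytope_vertices P)"
  unfolding polytope_vertices_def face_of_singleton
  by (rule Krein_Milman_Minkowski[OF polytope_imp_compact polytope_imp_convex, OF assms assms])

lemma polytope_vertices_subset_convex:
  assumes "polytope P" "polytope_vertices P \<subseteq> K" "convex K"
  shows "P \<subseteq> K"
  by (subst polytope_eq_convex_hull_vertices[OF assms(1)]) (simp add: hull_minimal assms)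

lemma finite_polytope_vertices: "polytope P \<Longrightarrow> finite (polytope_vertices P)"
  using simple_graph_polytope_graph[of P] by (simp add: simple_graph_def polytope_graph_def)

lemma polytope_vertices_face:
  "F face_of P \<Longrightarrow> polytope_vertices F = polytope_vertices P \<inter> F"
  by (auto simp: polytope_vertices_def face_of_face)

lemma polytope_vertices_subset: "polytope_vertices P \<subseteq> P"
  using face_of_imp_subset by (fastforce simp: polytope_vertices_def)

lemma polytope_vertices_closed_segment: "polytope_vertices (closed_segment a b) = {a, b}"
  by (auto simp: polytope_vertices_def face_of_singleton extreme_point_of_segment)

lemma edge_of_polytope_segment:
  assumes "polytope P" "e edge_of P"
  obtains a b where "a \<noteq> b" "e = closed_segment a b"
proof -
  have f: "e face_of P" and d: "aff_dim e = 1" using assms by (auto simp: edge_of_def)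
  have pe: "polytope e" using f assms face_of_polytope_polytope by blast
  have "compact e" "convex e" "collinear e" "e \<noteq> {}"
    using pe d by (auto simp: polytope_imp_compact polytope_imp_convex collinear_aff_dim)
  then obtain a b where "e = closed_segment a b"
    using compact_convex_collinear_segment by blast
  moreover have "a \<noteq> b" using d calculation by auto
  ultimately show thesis using that by blast
qed

lemma segment_edge_of_face:
  "F face_of P \<Longrightarrow> closed_segment a b edge_of F \<Longrightarrow> closed_segment a b edge_of P"
  by (auto simp: edge_of_def intro: face_of_trans)

lemma segment_edge_of_vertices:
  assumes "closed_segment a b edge_of P"
  shows "a \<in> polytope_vertices P" "b \<in> polytope_vertices P" "a \<noteq> b"
proof -
  have "polytope_vertices (closed_segment a b) = polytope_vertices P \<inter> closed_segment a b"
    using assms polytope_vertices_face by (auto simp: edge_of_def)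
  then show "a \<in> polytope_vertices P" "b \<in> polytope_vertices P"
    by (auto simp: polytope_vertices_closed_segment)
  show "a \<noteq> b" using assms by (auto simp: edge_of_def)
qed

text \<open>A point of a polytope outside the relative interior lies in a facet, so descend through
  facets. The induction measure is shifted by one because the empty set has dimension -1.\<close>

lemma polytope_in_rel_interior_of_face:
  fixes P :: "'a::euclidean_space set"
  assumes "polytope P" "x \<in> P"
  obtains F where "F face_of P" "x \<in> rel_interior F"
  using assms
proof (induction "nat (aff_dim P + 1)" arbitrary: P thesis rule: less_induct)
  case less
  show ?case
  proof (cases "x \<in> rel_interior P")
    case True
    then show ?thesis using less.prems face_of_refl polytope_imp_convex by metis
  next
    case False
    then obtain F where F: "F facet_of P" "x \<in> F"
      using rel_interior_of_polyhedron[OF polytope_imp_polyhedron[OF less.prems(2)]] less.prems(3)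
      by blast
    then have fac: "F face_of P" "aff_dim F = aff_dim P - 1" by (auto simp: facet_of_def)
    have "aff_dim F \<ge> 0" using F(2) aff_dim_subset[of "{x}" F] by simp
    then obtain G where "G face_of F" "x \<in> rel_interior G"
      using less.hyps[of F] fac F(2) face_of_polytope_polytope less.prems(2) by auto
    then show ?thesis using less.prems(1) face_of_trans fac by blast
  qed
qed

text \<open>Near \<open>q\<close> the affine hull of \<open>F\<close> agrees with \<open>F\<close>,
  so the hyperplane meets that hull in \<open>q\<close> alone; and cutting with a hyperplane through
  \<open>q\<close> loses at most one dimension.\<close>

lemma aff_dim_le_1_of_hyperplane_section:
  fixes F :: "'a::euclidean_space set"
  assumes "q \<in> rel_interior F" "F \<inter> {x. a \<bullet> x = c} = {q}"
  shows "aff_dim F \<le> 1"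
proof -
  let ?L = "affine hull F \<inter> {x. a \<bullet> x = c}"
  have q: "q \<in> affine hull F" "a \<bullet> q = c"
    using assms rel_interior_subset hull_subset[of F affine] by blast+
  have affL: "affine ?L" by (simp add: affine_Int affine_hyperplane)
  obtain U where U: "open U" "rel_interior F = affine hull F \<inter> U"
    using openin_rel_interior[of F] by (auto simp: openin_open)
  have "affine hull (?L \<inter> U) = ?L"
    using affine_hull_affine_Int_open[OF affL U(1)] U q assms(1) affL by (auto simp: hull_same)
  moreover have "?L \<inter> U \<subseteq> {q}"
    using assms(2) U rel_interior_subset[of F] by blast
  ultimately have "?L \<subseteq> {q}"
    by (metis affine_hull_sing hull_mono)
  then have "aff_dim ?L \<le> 0" by (metis aff_dim_sing aff_dim_subset)
  then show ?thesis
    using aff_dim_affine_Int_hyperplane[of "affine hull F" a c] q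
    by (auto split: if_splits)
qed

text \<open>The neighbour is read off a vertex of the vertex figure of \<open>v\<close>, the section of \<open>P\<close> by
  a hyperplane separating \<open>v\<close> from the other vertices.\<close>

lemma polytope_improving_edge:
  fixes P :: "'a::euclidean_space set"
  assumes P: "polytope P" and v: "v \<in> polytope_vertices P" and p: "p \<in> P" "n \<bullet> v < n \<bullet> p"
  obtains w where "closed_segment v w edge_of P" "n \<bullet> v < n \<bullet> w"
proof -
  have "{v} exposed_face_of P"
    using v exposed_face_of_polyhedron[OF polytope_imp_polyhedron[OF P]]
    by (simp add: polytope_vertices_def)
  then obtain a b where ab: "P \<subseteq> {x. a \<bullet> x \<le> b}" "{v} = P \<inter> {x. a \<bullet> x = b}"
    unfolding exposed_face_of_def by blast
  let ?W = "polytope_vertices P - {v}"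
  have W: "a \<bullet> w < b" if "w \<in> ?W" for w
    using ab that polytope_vertices_subset[of P] by (force simp: less_le)
  have av: "a \<bullet> v = b" using ab by blast
  have "\<not> polytope_vertices P \<subseteq> {x. n \<bullet> x \<le> n \<bullet> v}"
    using polytope_vertices_subset_convex[OF P _ convex_halfspace_le] p
    by (meson linorder_not_less mem_Collect_eq subsetD)
  then obtain w where w: "w \<in> ?W" "n \<bullet> v < n \<bullet> w" by force
  define m where "m = Max ((\<bullet>) a ` ?W)"
  have finW: "finite ?W" using finite_polytope_vertices[OF P] by simp
  have "m < b" unfolding m_def using finW w W by (subst Max_less_iff) auto
  \<comment> \<open>The hyperplane \<open>?H\<close> at level \<open>c\<close> has \<open>v\<close>
    strictly above it and all other vertices strictly below it.\<close>
  then obtain c where c: "m < c" "c < b" using dense by blast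
  have Wc: "a \<bullet> u < c" if "u \<in> ?W" for u
  proof -
    have "a \<bullet> u \<le> m" unfolding m_def using that finW by (intro Max_ge) auto
    then show ?thesis using c by simp
  qed
  let ?H = "{x. a \<bullet> x = c}"
  have Q: "polytope (P \<inter> ?H)" by (simp add: P polytope_Int_polyhedron polyhedron_hyperplane)
  \<comment> \<open>\<open>t\<close> is the parameter at which the segment from \<open>v\<close> to
    \<open>w\<close> crosses \<open>?H\<close>.\<close>
  define t where "t = (b - c) / (b - a \<bullet> w)"
  have t: "0 < t" "t < 1" "t * (b - a \<bullet> w) = b - c"
    using c Wc[OF w(1)] by (auto simp: t_def field_simps)
  define q0 where "q0 = (1 - t) *\<^sub>R v + t *\<^sub>R w"
  have "q0 \<in> P"
    using v w t polytope_vertices_subset[of P] polytope_imp_convex[OF P]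
    unfolding q0_def by (intro convexD) auto
  moreover have "a \<bullet> q0 = c" using t(3) av by (simp add: q0_def inner_simps algebra_simps)
  moreover have "n \<bullet> v < n \<bullet> q0"
  proof -
    have "n \<bullet> q0 - n \<bullet> v = t * (n \<bullet> w - n \<bullet> v)" by (simp add: q0_def inner_simps algebra_simps)
    also have "\<dots> > 0" using t w by simp
    finally show ?thesis by simp
  qed
  ultimately have "\<not> P \<inter> ?H \<subseteq> {x. n \<bullet> x \<le> n \<bullet> v}" by force
  then obtain q where q: "q \<in> polytope_vertices (P \<inter> ?H)" "n \<bullet> v < n \<bullet> q"
    using polytope_vertices_subset_convex[OF Q _ convex_halfspace_le]
    by (metis linorder_not_less mem_Collect_eq subsetI)
  have qP: "q \<in> P" "a \<bullet> q = c" using q polytope_vertices_subset[of "P \<inter> ?H"] by auto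
  obtain F where F: "F face_of P" "q \<in> rel_interior F"
    using polytope_in_rel_interior_of_face[OF P qP(1)] by blast
  have convF: "convex F" and qF: "q \<in> F" using F face_of_imp_convex rel_interior_subset by blast+
  have FH: "F \<inter> ?H face_of P \<inter> ?H" by (simp add: F face_of_slice convex_hyperplane)
  \<comment> \<open>A point that is both extreme and relatively interior must be the whole
    section.\<close>
  have "q extreme_point_of (F \<inter> ?H)"
    using q extreme_point_of_face[OF FH] qF qP by (simp add: polytope_vertices_def face_of_singleton)
  moreover have "q \<in> rel_interior (F \<inter> ?H)"
    using convex_affine_rel_interior_Int[OF convF affine_hyperplane, of a c] F qP by blast
  ultimately have "F \<inter> ?H = {q}" using extreme_point_not_in_REL_INTERIOR by blast
  then have dim_le: "aff_dim F \<le> 1" using aff_dim_le_1_of_hyperplane_section F by blast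
  have "F \<noteq> {q}"
  proof
    assume "F = {q}"
    then have "q \<in> polytope_vertices P" using F by (simp add: polytope_vertices_def)
    then show False using Wc qP av c by fastforce
  qed
  then have "aff_dim F \<noteq> 0" using qF aff_dim_eq_0[of F] by auto
  moreover have "aff_dim F \<noteq> -1" using qF by (metis aff_dim_empty empty_iff)
  ultimately have "F edge_of P"
    using F dim_le aff_dim_geq[of F] by (auto simp: edge_of_def)
  moreover obtain s u where su: "F = closed_segment s u"
    using edge_of_polytope_segment[OF P calculation] by blast
  ultimately have E: "closed_segment s u edge_of P" "closed_segment u s edge_of P"
    by (auto simp: closed_segment_commute)
  have mono: "g \<bullet> q \<le> max (g \<bullet> s) (g \<bullet> u)" for g
  proof -
    have "closed_segment s u \<subseteq> {x. g \<bullet> x \<le> max (g \<bullet> s) (g \<bullet> u)}"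
      by (intro closed_segment_subset convex_halfspace_le) auto
    then show ?thesis using qF su by auto
  qed
  \<comment> \<open>As \<open>a \<bullet> q = c\<close>, the ends of \<open>F\<close> cannot both
    lie below level \<open>c\<close>, and \<open>v\<close> is the only vertex that does not.\<close>
  have "s = v \<or> u = v"
    using mono[of a] qP Wc[of s] Wc[of u] segment_edge_of_vertices[OF E(1)] by fastforce
  then show thesis
  proof
    assume "s = v"
    then show thesis using that[of u] E mono[of n] q(2) by auto
  next
    assume "u = v"
    then show thesis using that[of s] E mono[of n] q(2) by auto
  qed
qed

section \<open>Balinski's theorem\<close>

text \<open>As in the simplex method, a maximiser of \<open>n\<close> over \<open>A\<close> is
  maximal on \<open>P\<close>, for otherwise an improving edge would lead to a higher vertex of
  \<open>A\<close>. Closure is asked only along rising edges that start no lower than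
  \<open>a0\<close>, so that Balinski's theorem can keep deleted vertices out of the climb.\<close>

lemma polytope_ascent:
  fixes P :: "'a::euclidean_space set"
  assumes P: "polytope P" and A: "A \<subseteq> polytope_vertices P" "a0 \<in> A"
    and up: "\<And>a b. \<lbrakk>a \<in> A; closed_segment a b edge_of P; n \<bullet> a0 \<le> n \<bullet> a; n \<bullet> a < n \<bullet> b\<rbrakk> \<Longrightarrow> b \<in> A"
  obtains a where "a \<in> A" "\<And>p. p \<in> P \<Longrightarrow> n \<bullet> p \<le> n \<bullet> a"
proof -
  have "finite A" using A finite_polytope_vertices[OF P] finite_subset by blast
  then have "Max ((\<bullet>) n ` A) \<in> (\<bullet>) n ` A" "\<And>x. x \<in> A \<Longrightarrow> n \<bullet> x \<le> Max ((\<bullet>) n ` A)"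
    using A(2) by (auto intro: Max_in)
  then obtain a where a: "a \<in> A" "\<And>x. x \<in> A \<Longrightarrow> n \<bullet> x \<le> n \<bullet> a" by auto
  have "n \<bullet> p \<le> n \<bullet> a" if p: "p \<in> P" for p
  proof (rule ccontr)
    assume "\<not> n \<bullet> p \<le> n \<bullet> a"
    then obtain w where w: "closed_segment a w edge_of P" "n \<bullet> a < n \<bullet> w"
      using polytope_improving_edge[OF P _ p, of a n] a A by (metis linorder_not_less subsetD)
    then have "w \<in> A" using up a A(2) by blast
    then show False using a w by fastforce
  qed
  with a(1) that show thesis by blast
qed

text \<open>Induction on the dimension: if \<open>A\<close> missed a vertex, both \<open>A\<close>
  and its complement would climb to the face where a functional is largest, yet by induction all
  vertices of that face lie in \<open>A\<close>.\<close>

lemma polytope_vertices_connected: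
  fixes P :: "'a::euclidean_space set"
  assumes "polytope P" "A \<subseteq> polytope_vertices P" "A \<noteq> {}"
    and "\<And>a b. \<lbrakk>a \<in> A; closed_segment a b edge_of P\<rbrakk> \<Longrightarrow> b \<in> A"
  shows "A = polytope_vertices P"
  using assms
proof (induction "nat (aff_dim P + 1)" arbitrary: P A rule: less_induct)
  case less
  note P = less.prems(1)
  show ?case
  proof (rule ccontr)
    assume "A \<noteq> polytope_vertices P"
    then obtain w u where w: "w \<in> polytope_vertices P - A" and u: "u \<in> A"
      using less.prems(2,3) by blast
    \<comment> \<open>This choice keeps \<open>u\<close> off the top face \<open>?M\<close>, which
      therefore has smaller dimension than \<open>P\<close>.\<close>
    define n where "n = w - u"
    have "w \<noteq> u" using w u by auto
    then have uw: "n \<bullet> u < n \<bullet> w"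
      using inner_gt_zero_iff[of "w - u"] by (simp add: n_def inner_diff_right)
    obtain a where a: "a \<in> A" "\<And>p. p \<in> P \<Longrightarrow> n \<bullet> p \<le> n \<bullet> a"
      using polytope_ascent[OF P less.prems(2) u] less.prems(4) by metis
    have compl: "b \<in> polytope_vertices P - A"
      if "x \<in> polytope_vertices P - A" "closed_segment x b edge_of P" for x b
      using that less.prems(4)[of b x] segment_edge_of_vertices(2)[OF that(2)]
      by (auto simp: closed_segment_commute)
    obtain b where b: "b \<in> polytope_vertices P - A" "\<And>p. p \<in> P \<Longrightarrow> n \<bullet> p \<le> n \<bullet> b"
      using polytope_ascent[OF P Diff_subset w] compl by metis
    let ?M = "P \<inter> {x. n \<bullet> x = n \<bullet> a}"
    have M: "?M face_of P"
      using a P by (intro face_of_Int_supporting_hyperplane_le polytope_imp_convex) auto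
    have sub: "polytope_vertices P \<subseteq> P" by (rule polytope_vertices_subset)
    have "u \<notin> ?M" using uw a(2)[of w] w sub by auto
    then have "?M \<noteq> P" using u less.prems(2) sub by blast
    then have "aff_dim ?M < aff_dim P" using M P face_of_aff_dim_lt polytope_imp_convex by blast
    moreover have "a \<in> ?M" using a less.prems(2) sub by auto
    then have "aff_dim ?M \<ge> 0" using aff_dim_subset[of "{a}" ?M] by simp
    ultimately have "A \<inter> ?M = polytope_vertices ?M"
      using less.prems(2) \<open>a \<in> ?M\<close> a(1) face_of_polytope_polytope[OF P M] less.prems(4)
        segment_edge_of_face[OF M] segment_edge_of_vertices(2)
      by (intro less.hyps) (fastforce simp: polytope_vertices_face[OF M])+
    moreover have "n \<bullet> b = n \<bullet> a" using a b sub less.prems(2) by (intro antisym) auto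
    ultimately show False using b sub polytope_vertices_face[OF M] by auto
  qed
qed

text \<open>The differences \<open>s - v\<close> span less than the directions of \<open>P\<close>,
  so some nonzero \<open>n\<close> among the latter is orthogonal to them. Were \<open>n\<close>
  constant on \<open>P\<close>, it would be orthogonal to itself.\<close>

lemma exists_functional_constant_on_small_set:
  fixes P :: "'a::euclidean_space set"
  assumes "finite S" "S \<subseteq> P" "v \<in> P" "card S < d" "aff_dim P = int d"
  obtains n p where "\<And>s. s \<in> S \<Longrightarrow> n \<bullet> s = n \<bullet> v" "p \<in> P" "n \<bullet> p \<noteq> n \<bullet> v"
proof -
  let ?t = "(\<lambda>x. x - v)"
  have "dim (?t ` S) \<le> card (?t ` S)" using assms(1) by (intro dim_le_card') auto
  also have "\<dots> < d" using card_image_le[OF assms(1), of ?t] assms(4) by simp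
  also have "d = dim (?t ` P)"
    using aff_dim_eq_dim_subtract[of v P] assms(3,5) hull_inc by fastforce
  finally have "dim (?t ` S) < dim (?t ` P)" .
  moreover have "span (?t ` S) \<subseteq> span (?t ` P)" using assms(2) by (intro span_mono) auto
  ultimately have "span (?t ` S) \<subset> span (?t ` P)" by (metis dim_span less_irrefl psubsetI)
  then obtain n where n: "n \<noteq> 0" "n \<in> span (?t ` P)" "\<And>y. y \<in> span (?t ` S) \<Longrightarrow> orthogonal n y"
    using orthogonal_to_subspace_exists_gen by blast
  have "n \<bullet> s = n \<bullet> v" if "s \<in> S" for s
    using n(3)[of "s - v"] that by (auto simp: span_base orthogonal_def inner_diff_right)
  moreover have "\<exists>p\<in>P. n \<bullet> p \<noteq> n \<bullet> v"
  proof (rule ccontr)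
    assume "\<not> ?thesis"
    then have "orthogonal n y" if "y \<in> ?t ` P" for y
      using that by (auto simp: orthogonal_def inner_diff_right)
    then have "orthogonal n n" using n(2) orthogonal_to_span by blast
    then show False using n(1) by (simp add: orthogonal_def)
  qed
  ultimately show thesis using that by blast
qed

text \<open>Suppose \<open>b\<close> is a remaining vertex outside \<open>A\<close>, and take a
  functional constant on \<open>S\<close> and a vertex \<open>v\<close> of \<open>A\<close>, but not
  on \<open>P\<close>. If \<open>P\<close> rises above that level, \<open>b\<close> must lie
  strictly below it, or else \<open>A\<close> and the rest would meet in the top face. Then
  \<open>P\<close> also extends below the level, and the reversed functional puts \<open>b\<close>
  above it.\<close>

theorem balinski:
  fixes P :: "'a::euclidean_space set"
  assumes P: "polytope P" and d: "aff_dim P = int d"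
    and S: "S \<subseteq> polytope_vertices P" "card S < d"
    and A: "A \<subseteq> polytope_vertices P - S" "A \<noteq> {}"
    and closed: "\<And>a b. \<lbrakk>a \<in> A; closed_segment a b edge_of P; b \<notin> S\<rbrakk> \<Longrightarrow> b \<in> A"
  shows "A = polytope_vertices P - S"
proof (rule ccontr)
  define B where "B = polytope_vertices P - S - A"
  assume "A \<noteq> polytope_vertices P - S"
  then obtain b where b: "b \<in> B" using A unfolding B_def by blast
  have sub: "polytope_vertices P \<subseteq> P" by (rule polytope_vertices_subset)
  obtain v where v: "v \<in> A" using A by blast
  have vP: "v \<in> P" "S \<subseteq> P" using v A S sub by auto
  have finS: "finite S" using S finite_polytope_vertices[OF P] finite_subset by blast
  have closedB: "y \<in> B" if "x \<in> B" "closed_segment x y edge_of P" "y \<notin> S" for x y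
    using that closed[of y x] segment_edge_of_vertices(2)[OF that(2)]
    by (auto simp: B_def closed_segment_commute)
  \<comment> \<open>Above the level of \<open>S\<close>, both \<open>A\<close> and \<open>B\<close> would climb to the top face, which is connected.\<close>
  have below: "n \<bullet> y < n \<bullet> v"
    if y: "y \<in> B" and nS: "\<And>s. s \<in> S \<Longrightarrow> n \<bullet> s = n \<bullet> v" and p: "p \<in> P" "n \<bullet> v < n \<bullet> p" for n p y
  proof (rule ccontr)
    assume "\<not> n \<bullet> y < n \<bullet> v"
    then have yv: "n \<bullet> v \<le> n \<bullet> y" by simp
    have notS: "x \<notin> S" if "n \<bullet> v < n \<bullet> x" for x using that nS by force
    obtain a where a: "a \<in> A" "\<And>x. x \<in> P \<Longrightarrow> n \<bullet> x \<le> n \<bullet> a"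
      using polytope_ascent[OF P _ v, of n] A closed notS by (smt (verit) Diff_subset subset_trans)
    obtain c where c: "c \<in> B" "\<And>x. x \<in> P \<Longrightarrow> n \<bullet> x \<le> n \<bullet> c"
      using polytope_ascent[OF P _ y, of n] closedB notS yv B_def
      by (smt (verit) Diff_subset subset_trans)
    let ?M = "P \<inter> {x. n \<bullet> x = n \<bullet> a}"
    have M: "?M face_of P"
      using a P by (intro face_of_Int_supporting_hyperplane_le polytope_imp_convex) auto
    \<comment> \<open>The point \<open>p\<close> forces the maximum above the common level of
      \<open>S\<close>, so the top face avoids \<open>S\<close>.\<close>
    have MS: "x \<notin> S" if "x \<in> ?M" for x using notS[of x] a(2)[OF p(1)] p(2) that by auto
    have "A \<inter> ?M = polytope_vertices ?M"
    proof (rule polytope_vertices_connected)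
      show "polytope ?M" using face_of_polytope_polytope[OF P M] .
      show "A \<inter> ?M \<subseteq> polytope_vertices ?M" using A by (auto simp: polytope_vertices_face[OF M])
      show "A \<inter> ?M \<noteq> {}" using a A sub by auto
      fix x z assume x: "x \<in> A \<inter> ?M" and e: "closed_segment x z edge_of ?M"
      have "z \<in> ?M" using segment_edge_of_vertices(2)[OF e] polytope_vertices_subset by blast
      then show "z \<in> A \<inter> ?M" using closed[of x z] x segment_edge_of_face[OF M e] MS by blast
    qed
    moreover have "n \<bullet> c = n \<bullet> a" using a c sub A by (intro antisym) (auto simp: B_def)
    ultimately show False using c sub polytope_vertices_face[OF M] by (auto simp: B_def)
  qed
  obtain n p where n: "\<And>s. s \<in> S \<Longrightarrow> n \<bullet> s = n \<bullet> v" and p: "p \<in> P" "n \<bullet> p \<noteq> n \<bullet> v"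
    using exists_functional_constant_on_small_set[OF finS vP(2,1) S(2) d] by blast
  have up: "n \<bullet> b < n \<bullet> v" if "q \<in> P" "n \<bullet> v < n \<bullet> q" for q
    using below[OF b n that] .
  have down: "n \<bullet> v < n \<bullet> b" if "q \<in> P" "n \<bullet> q < n \<bullet> v" for q
    using below[of b "- n" q] b n that by simp
  have "b \<in> P" using b sub by (auto simp: B_def)
  then show False using up[of p] down[of p] up[of b] down[of b] p
    by (meson linorder_neqE not_less_iff_gr_or_eq)
qed

section \<open>Edge cuts of simplicial polytopes\<close>

text \<open>Any two vertices of a simplex span an edge, and the isomorphism of face lattices carries
  this over to \<open>F\<close>. It maps faces, not points, so vertices are recognised as minimal
  nonempty faces.\<close>

lemma simplicial_facet_vertices_adjacent:
  fixes P :: "'a::euclidean_space set"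
  assumes P: "simplicial_polytope P" and F: "F facet_of P"
    and uv: "u \<in> polytope_vertices F" "v \<in> polytope_vertices F" "u \<noteq> v"
  shows "closed_segment u v edge_of P"
proof -
  have polyF: "polytope F"
    using P F face_of_polytope_polytope by (auto simp: simplicial_polytope_def facet_of_def)
  obtain S :: "'a set" and k where "k simplex S" "combinatorially_isomorphic F S"
    using P F unfolding simplicial_polytope_def by blast
  then obtain K f where K: "\<not> affine_dependent K" "S = convex hull K"
    and bij: "bij_betw f {G. G face_of F} {G. G face_of S}"
    and iso: "\<And>G H. G face_of F \<Longrightarrow> H face_of F \<Longrightarrow> G \<subseteq> H \<longleftrightarrow> f G \<subseteq> f H"
    unfolding simplex_def combinatorially_isomorphic_def by blast
  have face_S: "T face_of S \<longleftrightarrow> (\<exists>c\<subseteq>K. T = convex hull c)" for T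
    using face_of_convex_hull_affine_independent[OF K(1)] K(2) by simp
  have surj: "\<exists>G. G face_of F \<and> f G = H" if "H face_of S" for H
    using bij_betw_imp_surj_on[OF bij] that by (metis (mono_tags, lifting) imageE mem_Collect_eq)
  have inj: "G = H" if "G face_of F" "H face_of F" "f G = f H" for G H
    using iso that by blast
  have f_face: "f G face_of S" if "G face_of F" for G
    using bij_betwE[OF bij] that by blast
  have f_empty: "f {} = {}"
    using surj[of "{}"] iso[of "{}"] by auto
  \<comment> \<open>Pick a vertex \<open>z\<close> of \<open>f {x}\<close>. The face mapped to
    \<open>{z}\<close> is nonempty and contained in \<open>{x}\<close>, hence equal to it.\<close>
  have vertex: "\<exists>z\<in>K. f {x} = {z}" if x: "x \<in> polytope_vertices F" for x
  proof -
    have xF: "{x} face_of F" using x by (simp add: polytope_vertices_def)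
    have "f {x} \<noteq> {}" using inj[OF xF, of "{}"] f_empty by auto
    then obtain c z where c: "c \<subseteq> K" "f {x} = convex hull c" "z \<in> c"
      using f_face[OF xF] by (metis convex_hull_eq_empty equals0I face_S)
    have "{z} face_of S" using c by (auto simp: face_S intro!: exI[of _ "{z}"])
    then obtain G where G: "G face_of F" "f G = {z}" using surj by blast
    have "f G \<subseteq> f {x}" using c G hull_inc by fastforce
    then have "G \<subseteq> {x}" using iso G xF by blast
    moreover have "G \<noteq> {}" using G f_empty by auto
    ultimately have "G = {x}" by blast
    then show ?thesis using G c by blast
  qed
  obtain a b where ab: "a \<in> K" "b \<in> K" "f {u} = {a}" "f {v} = {b}"
    using vertex uv by meson
  have "convex hull {a, b} face_of S" using ab by (auto simp: face_S intro!: exI[of _ "{a, b}"])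
  then obtain E where E: "E face_of F" "f E = convex hull {a, b}" using surj by blast
  have "polytope_vertices E = {u, v}"
  proof (intro equalityI subsetI)
    fix x assume x: "x \<in> polytope_vertices E"
    then have xF: "x \<in> polytope_vertices F" "{x} face_of F" "x \<in> E"
      using polytope_vertices_face[OF E(1)] by (auto simp: polytope_vertices_def)
    obtain z where z: "z \<in> K" "f {x} = {z}" using vertex[OF xF(1)] by blast
    have "{z} \<subseteq> convex hull {a, b}" using iso[OF xF(2) E(1)] xF(3) z E(2) by auto
    moreover have "z extreme_point_of S"
      using K z extreme_point_of_convex_hull_affine_independent by blast
    ultimately have "z extreme_point_of (convex hull {a, b})"
      using extreme_point_of_face \<open>convex hull {a, b} face_of S\<close> by blast
    then have "z = a \<or> z = b" using extreme_point_of_convex_hull by blast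
    then have "{x} = {u} \<or> {x} = {v}"
      using inj[OF xF(2)] z ab uv by (auto simp: polytope_vertices_def)
    then show "x \<in> {u, v}" by blast
  next
    have "{u} face_of F" "{v} face_of F" using uv by (auto simp: polytope_vertices_def)
    moreover have "f {u} \<subseteq> f E" "f {v} \<subseteq> f E"
      using E(2) ab hull_subset[of "{a, b}" convex] by auto
    ultimately have "{u} \<subseteq> E" "{v} \<subseteq> E" using iso[OF _ E(1)] by blast+
    then show "x \<in> polytope_vertices E" if "x \<in> {u, v}" for x
      using that uv polytope_vertices_face[OF E(1)] by auto
  qed
  then have "convex hull (polytope_vertices E) = closed_segment u v"
    by (simp only: segment_convex_hull)
  then have "E = closed_segment u v"
    using polytope_eq_convex_hull_vertices[OF face_of_polytope_polytope[OF polyF E(1)]]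
    by (rule trans[rotated])
  moreover have "aff_dim (closed_segment u v) = 1"
    using uv(3) by (simp add: segment_convex_hull aff_dim_convex_hull)
  ultimately show ?thesis
    using E(1) F face_of_trans by (auto simp: edge_of_def facet_of_def)
qed

lemma simplicial_edge_common_neighbours:
  fixes P :: "'a::euclidean_space set"
  assumes simp: "simplicial_polytope P" and d: "aff_dim P = int d" "d \<ge> 3"
    and ab: "closed_segment a b edge_of P"
  obtains T where "finite T" "d - 1 \<le> card T" "a \<notin> T" "b \<notin> T"
    "\<And>t. t \<in> T \<Longrightarrow> closed_segment a t edge_of P \<and> closed_segment b t edge_of P"
proof -
  let ?e = "closed_segment a b"
  have P: "polytope P" using simp by (simp add: simplicial_polytope_def)
  have e: "?e face_of P" "aff_dim ?e = 1" using ab by (auto simp: edge_of_def)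
  have "?e \<noteq> P" using e d by auto
  then have inter: "?e = \<Inter>{F. F facet_of P \<and> ?e \<subseteq> F}"
    using face_of_polyhedron[OF polytope_imp_polyhedron[OF P] e(1)] by auto
  obtain F1 where F1: "F1 facet_of P" "?e \<subseteq> F1"
    using face_of_polyhedron_subset_facet[OF polytope_imp_polyhedron[OF P] e(1)] \<open>?e \<noteq> P\<close> by auto
  have dimF: "aff_dim F = int d - 1" if "F facet_of P" for F using that d by (simp add: facet_of_def)
  have poly: "polytope F" if "F facet_of P" for F
    using that P face_of_polytope_polytope by (auto simp: facet_of_def)
  \<comment> \<open>The edge is the intersection of the facets containing it and \<open>F1\<close>
    is strictly larger, so another facet passes through the edge.\<close>
  have "F1 \<noteq> ?e" using dimF[OF F1(1)] e d by auto
  then obtain x where "x \<in> F1" "x \<notin> ?e" using F1 by blast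
  then obtain F2 where F2: "F2 facet_of P" "?e \<subseteq> F2" "F2 \<noteq> F1" using inter by blast
  have "\<not> polytope_vertices F2 \<subseteq> F1"
  proof
    assume "polytope_vertices F2 \<subseteq> F1"
    then have "F2 \<subseteq> F1"
      using polytope_vertices_subset_convex poly polytope_imp_convex F1 F2 by blast
    then have "F2 face_of F1"
      using F1 F2 by (meson face_of_face facet_of_imp_face_of)
    then show False
      using face_of_aff_dim_lt[of F1 F2] F2 dimF F1 poly polytope_imp_convex by fastforce
  qed
  then obtain t where t: "t \<in> polytope_vertices F2" "t \<notin> F1" by blast
  have ab_in: "a \<in> polytope_vertices F \<and> b \<in> polytope_vertices F" if "F facet_of P" "?e \<subseteq> F" for F
    using segment_edge_of_vertices[OF ab] polytope_vertices_face[of F P] that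
    by (auto simp: facet_of_def)
  have fin: "finite (polytope_vertices F1)" using finite_polytope_vertices poly F1 by blast
  have "aff_dim F1 = aff_dim (convex hull (polytope_vertices F1))"
    by (rule arg_cong[OF polytope_eq_convex_hull_vertices[OF poly[OF F1(1)]]])
  then have "d \<le> card (polytope_vertices F1)"
    using aff_dim_le_card[OF fin] dimF[OF F1(1)] by (simp add: aff_dim_convex_hull)
  then have "d - 2 \<le> card (polytope_vertices F1 - {a, b})"
    using ab_in[OF F1] fin segment_edge_of_vertices(3)[OF ab] by (simp add: card_Diff_subset)
  moreover have "t \<notin> polytope_vertices F1 - {a, b}" using t polytope_vertices_subset by blast
  ultimately have "d - 1 \<le> card (insert t (polytope_vertices F1 - {a, b}))"
    using fin d by simp
  moreover have "t \<noteq> a" "t \<noteq> b" using t F1 by auto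
  ultimately show thesis
    using that[of "insert t (polytope_vertices F1 - {a, b})"] fin t ab_in[OF F1] ab_in[OF F2(1,2)]
      simplicial_facet_vertices_adjacent[OF simp F1(1)]
      simplicial_facet_vertices_adjacent[OF simp F2(1)]
    by auto
qed

section \<open>Edge cuts as bipartite relations\<close>

lemma edges_polytope_graph_iff:
  fixes P :: "'a::euclidean_space set"
  assumes "polytope P"
  shows "{a, b} \<in> edges (polytope_graph P) \<longleftrightarrow> closed_segment a b edge_of P"
proof -
  have segment_vertices: "closed_segment s t \<inter> polytope_vertices P = {s, t}"
    if "closed_segment s t edge_of P" for s t
    using polytope_vertices_face[of "closed_segment s t" P] polytope_vertices_closed_segment that
    unfolding edge_of_def by (metis Int_commute)
  show ?thesis
  proof
    assume "{a, b} \<in> edges (polytope_graph P)"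
    then obtain e where e: "e edge_of P" "{a, b} = e \<inter> polytope_vertices P"
      by (auto simp: polytope_graph_def)
    obtain s t where st: "e = closed_segment s t" using edge_of_polytope_segment[OF assms e(1)] by blast
    have "e \<inter> polytope_vertices P = {s, t}"
      using segment_vertices e(1) unfolding st .
    then have "a = s \<and> b = t \<or> a = t \<and> b = s" using e(2) by (simp add: doubleton_eq_iff)
    then have "closed_segment a b = e" by (metis closed_segment_commute st)
    then show "closed_segment a b edge_of P" using e(1) by simp
  next
    assume ab: "closed_segment a b edge_of P"
    show "{a, b} \<in> edges (polytope_graph P)"
      using segment_vertices[OF ab] ab unfolding polytope_graph_def by auto
  qed
qed

text \<open>Directing each cut edge out of \<open>X\<close> turns the cut into a bipartite relation,
  so that Koenig's theorem applies and degrees within the cut are fibres.\<close>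

definition cut_pairs :: "'a::euclidean_space set \<Rightarrow> 'a set \<Rightarrow> ('a \<times> 'a) set" where
  "cut_pairs P X = {(x, y). x \<in> X \<and> y \<in> polytope_vertices P - X \<and> closed_segment x y edge_of P}"

lemma card_edges_between_polytope_graph:
  assumes "polytope P"
  shows "card (edges_between (polytope_graph P) X (polytope_vertices P - X)) = card (cut_pairs P X)"
proof -
  have "edges_between (polytope_graph P) X (polytope_vertices P - X) =
      (\<lambda>(x, y). {x, y}) ` cut_pairs P X"
    using edges_polytope_graph_iff[OF assms]
    by (auto simp: edges_between_def cut_pairs_def image_iff)
  moreover have "inj_on (\<lambda>(x, y). {x, y}) (cut_pairs P X)"
    by (auto simp: inj_on_def cut_pairs_def doubleton_eq_iff)
  ultimately show ?thesis by (simp add: card_image)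
qed

lemma finite_cut_pairs:
  assumes "polytope P"
  shows "finite (cut_pairs P X)"
  by (rule finite_subset[of _ "polytope_vertices P \<times> polytope_vertices P"])
    (use finite_polytope_vertices[OF assms] segment_edge_of_vertices in \<open>auto simp: cut_pairs_def\<close>)

lemma cut_pairs_compl:
  "X \<subseteq> polytope_vertices P \<Longrightarrow> cut_pairs P (polytope_vertices P - X) = (cut_pairs P X)\<inverse>"
  by (auto simp: cut_pairs_def closed_segment_commute)

text \<open>A side with \<open>k\<close> vertices, each of degree at least the cut size \<open>m\<close>, sends at least
  \<open>k (m - k + 1)\<close> edges across, which exceeds \<open>m\<close> unless \<open>k \<le> 1\<close> or \<open>m \<le> k\<close>.\<close>

lemma cut_size_le_side:
  fixes P :: "'a::euclidean_space set"
  assumes P: "polytope P" and X: "X \<subseteq> polytope_vertices P" "2 \<le> card X"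
    and deg: "\<And>v. v \<in> X \<Longrightarrow> card (cut_pairs P X) \<le> card {y. closed_segment v y edge_of P}"
  shows "card (cut_pairs P X) \<le> card X"
proof (rule ccontr)
  let ?m = "card (cut_pairs P X)" and ?k = "card X"
  assume "\<not> ?thesis"
  then have "?m = ?k + (?m - ?k)" "?m - ?k \<ge> 1" by auto
  then obtain j where j: "?m = ?k + j" "j \<ge> 1" by blast
  have finV: "finite (polytope_vertices P)" using finite_polytope_vertices[OF P] .
  have finX: "finite X" using X finV finite_subset by blast
  \<comment> \<open>At most \<open>?k - 1\<close> neighbours of \<open>v\<close> lie in
    \<open>X\<close>, which leaves at least \<open>?m - (?k - 1) = j + 1\<close> across the
    cut.\<close>
  have "j + 1 \<le> card {y. (v, y) \<in> cut_pairs P X}" if v: "v \<in> X" for v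
  proof -
    let ?R = "{y. (v, y) \<in> cut_pairs P X}"
    have finR: "finite ?R" by (rule finite_subset[OF _ finV]) (auto simp: cut_pairs_def)
    have "y \<in> (X - {v}) \<union> ?R" if "closed_segment v y edge_of P" for y
      using v that segment_edge_of_vertices(2,3)[OF that] by (auto simp: cut_pairs_def)
    then have "{y. closed_segment v y edge_of P} \<subseteq> (X - {v}) \<union> ?R" by blast
    then have "card {y. closed_segment v y edge_of P} \<le> card ((X - {v}) \<union> ?R)"
      using finX finR by (intro card_mono) auto
    also have "\<dots> \<le> card (X - {v}) + card ?R" by (rule card_Un_le)
    also have "\<dots> = ?k - 1 + card ?R" using v finX by simp
    finally show ?thesis using deg[OF v] j X by linarith
  qed
  then have "?k * (j + 1) \<le> (\<Sum>v\<in>X. card {y. (v, y) \<in> cut_pairs P X})"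
    using sum_bounded_below[of X "j + 1" "\<lambda>v. card {y. (v, y) \<in> cut_pairs P X}"] by simp
  also have "\<dots> \<le> ?m" using sum_fibres_le_card[OF finite_cut_pairs[OF P] finX] .
  finally have "?k * j \<le> 1 * j" unfolding j(1) by simp
  then have "?k \<le> 1" using j(2) by (metis mult_le_cancel2 less_le_trans zero_less_one)
  then show False using X(2) by simp
qed

text \<open>A common neighbour \<open>t\<close> of \<open>a\<close> and \<open>b\<close> gives the
  pair \<open>(a, t)\<close> if it is outside \<open>X\<close> and \<open>(t, b)\<close> if it is in
  \<open>X\<close>. Besides these \<open>d - 1\<close> pairs, \<open>(a, b)\<close> itself is
  counted in both fibres.\<close>

lemma cut_pairs_degree_sum:
  fixes P :: "'a::euclidean_space set"
  assumes simp: "simplicial_polytope P" and d: "aff_dim P = int d" "d \<ge> 3"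
    and ab: "(a, b) \<in> cut_pairs P X"
  shows "d + 1 \<le> card {y. (a, y) \<in> cut_pairs P X} + card {x. (x, b) \<in> cut_pairs P X}"
proof -
  have P: "polytope P" using simp by (simp add: simplicial_polytope_def)
  have e: "closed_segment a b edge_of P" "a \<in> X" "b \<notin> X" using ab by (auto simp: cut_pairs_def)
  obtain T where T: "finite T" "d - 1 \<le> card T" "a \<notin> T" "b \<notin> T"
    "\<And>t. t \<in> T \<Longrightarrow> closed_segment a t edge_of P \<and> closed_segment b t edge_of P"
    using simplicial_edge_common_neighbours[OF simp d e(1)] by blast
  let ?E = "cut_pairs P X"
  have fin: "finite {y. (a, y) \<in> ?E}" "finite {x. (x, b) \<in> ?E}"
    using finite_polytope_vertices[OF P] segment_edge_of_vertices(1)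
    by (auto intro!: finite_subset[of _ "polytope_vertices P"] simp: cut_pairs_def)
  have "(a, t) \<in> ?E" if "t \<in> T - X" for t
    using T(5)[of t] segment_edge_of_vertices(2)[of a t P] that e(2) by (auto simp: cut_pairs_def)
  then have "insert b (T - X) \<subseteq> {y. (a, y) \<in> ?E}" using ab by blast
  then have "card (insert b (T - X)) \<le> card {y. (a, y) \<in> ?E}" by (intro card_mono fin)
  moreover have "(t, b) \<in> ?E" if "t \<in> T \<inter> X" for t
    using T(5)[of t] that ab by (simp add: cut_pairs_def closed_segment_commute)
  then have "insert a (T \<inter> X) \<subseteq> {x. (x, b) \<in> ?E}" using ab by blast
  then have "card (insert a (T \<inter> X)) \<le> card {x. (x, b) \<in> ?E}" by (intro card_mono fin)
  moreover have "card (T - X) + card (T \<inter> X) = card T"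
    using T(1) by (metis add.commute card_Int_Diff)
  ultimately show ?thesis using T d by simp
qed

lemma card_fibres_le:
  assumes "finite E" "(a, b) \<in> E"
  shows "card {y. (a, y) \<in> E} + card {x. (x, b) \<in> E} \<le> card E + 1"
proof -
  let ?A = "Pair a ` {y. (a, y) \<in> E}" and ?B = "(\<lambda>x. (x, b)) ` {x. (x, b) \<in> E}"
  have sub: "?A \<union> ?B \<subseteq> E" by auto
  then have fin: "finite ?A" "finite ?B" using finite_subset[OF _ assms(1)] by blast+
  have "?A \<inter> ?B = {(a, b)}" using assms(2) by auto
  then have "card ?A + card ?B = card (?A \<union> ?B) + 1" using card_Un_Int[OF fin] by simp
  also have "\<dots> \<le> card E + 1" using card_mono[OF assms(1) sub] by simp
  finally show ?thesis by (simp add: card_image inj_on_def)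
qed

text \<open>Deleting a cover with fewer than \<open>d\<close> vertices would leave vertices on both
  sides but no edge between them, against Balinski's theorem.\<close>

lemma cut_pairs_cover:
  fixes P :: "'a::euclidean_space set"
  assumes P: "polytope P" and d: "aff_dim P = int d"
    and X: "X \<subseteq> polytope_vertices P" "d \<le> card X" "d \<le> card (polytope_vertices P - X)"
    and cover: "finite S" "finite T" "cut_pairs P X \<subseteq> S \<times> UNIV \<union> UNIV \<times> T"
  shows "d \<le> card S + card T"
proof (rule ccontr)
  let ?Y = "polytope_vertices P - X"
  \<comment> \<open>Restricted to their own sides, \<open>S\<close> and \<open>T\<close> still cover
    the cut and consist of vertices of \<open>P\<close>.\<close>
  define Z where "Z = (S \<inter> X) \<union> (T \<inter> ?Y)"
  assume "\<not> ?thesis"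
  moreover have "card Z \<le> card S + card T"
    unfolding Z_def using cover(1,2)
    by (intro order_trans[OF card_Un_le] add_mono card_mono) auto
  ultimately have Z: "card Z < d" "finite Z" "Z \<subseteq> polytope_vertices P"
    using cover X by (auto simp: Z_def)
  have large: "\<not> W \<subseteq> Z" if "d \<le> card W" for W
    using card_mono[OF Z(2), of W] Z(1) that by linarith
  have "X - Z = polytope_vertices P - Z"
  proof (rule balinski[OF P d Z(3,1)])
    show "X - Z \<subseteq> polytope_vertices P - Z" using X by blast
    show "X - Z \<noteq> {}" using large[OF X(2)] by blast
    fix a b assume ab: "a \<in> X - Z" "closed_segment a b edge_of P" "b \<notin> Z"
    show "b \<in> X - Z"
    proof (rule ccontr)
      assume "b \<notin> X - Z"
      then have "(a, b) \<in> cut_pairs P X" "b \<in> ?Y"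
        using ab segment_edge_of_vertices(2)[OF ab(2)] by (auto simp: cut_pairs_def)
      then show False using cover(3) ab by (auto simp: Z_def)
    qed
  qed
  then show False using large[OF X(3)] by blast
qed

theorem theorem9:
  fixes P :: "'a::euclidean_space set" and d :: nat and C :: "'a set set"
  assumes "d \<ge> 3"
    and "simplicial_polytope P"
    and "aff_dim P = int d"
    and "minimum_edge_cut (polytope_graph P) C"
    and "card C \<le> 4 * d - 7"
  shows "trivial_edge_cut (polytope_graph P) C"
proof (rule ccontr)
  assume nontriv: "\<not> trivial_edge_cut (polytope_graph P) C"
  let ?V = "polytope_vertices P" and ?G = "polytope_graph P"
  have P: "polytope P" using assms(2) by (simp add: simplicial_polytope_def)
  have V[simp]: "verts ?G = ?V" by (simp add: polytope_graph_def)
  have finV: "finite ?V" using finite_polytope_vertices[OF P] .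
  have cut: "edge_cut ?G C" and least: "\<And>D. edge_cut ?G D \<Longrightarrow> card C \<le> card D"
    using assms(4) by (auto simp: minimum_edge_cut_def)
  obtain X where X: "X \<noteq> {}" "X \<subset> ?V" "C = edges_between ?G X (?V - X)"
    using cut by (auto simp: edge_cut_def)
  let ?E = "cut_pairs P X"
  have CE: "card C = card ?E" using card_edges_between_polytope_graph[OF P] X(3) by simp
  have finE: "finite ?E" using finite_cut_pairs[OF P] .
  have sides: "X \<subseteq> ?V" "?V - X \<subseteq> ?V" using X by auto
  \<comment> \<open>The edges at \<open>v\<close> form an edge cut, so the minimum cut is no larger
    than the degree of \<open>v\<close>.\<close>
  have deg: "card C \<le> card {y. closed_segment v y edge_of P}" if v: "v \<in> ?V" for v
  proof -
    obtain x y where "x \<in> X" "y \<in> ?V - X" using X(1,2) by blast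
    then have "{v} \<noteq> ?V" using X(2) by (metis Diff_iff psubsetD singletonD)
    then have "{v} \<subset> ?V" using v by blast
    then have "edge_cut ?G (edges_between ?G {v} (?V - {v}))"
      unfolding edge_cut_def V by blast
    then have "card C \<le> card (cut_pairs P {v})"
      using least card_edges_between_polytope_graph[OF P] by metis
    also have "cut_pairs P {v} = Pair v ` {y. closed_segment v y edge_of P}"
      using segment_edge_of_vertices(2,3)[of v _ P] by (auto simp: cut_pairs_def)
    finally show ?thesis by (simp add: card_image inj_on_def)
  qed
  have not_single: "W \<noteq> {v}" if W: "W = X \<or> W = ?V - X" for W v
  proof
    assume Wv: "W = {v}"
    have v: "v \<in> ?V" using W Wv X by blast
    have C: "C = edges_between ?G {v} (?V - {v})"
      using W
    proof
      assume "W = ?V - X"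
      then have "X = ?V - {v}" "?V - X = {v}" using Wv X(2) by auto
      then show ?thesis unfolding X(3) by (auto simp: edges_between_def insert_commute)
    qed (use X(3) Wv in simp)
    have "e \<in> edges_between ?G {v} (?V - {v})" if e: "e \<in> edges ?G" "v \<in> e" for e
    proof -
      have "e \<subseteq> ?V" "card e = 2"
        using e simple_graph_polytope_graph[OF P] by (auto simp: simple_graph_def)
      then obtain y where "e = {v, y}" "y \<noteq> v" using e(2) by (auto simp: card_2_iff)
      then show ?thesis using e \<open>e \<subseteq> ?V\<close> by (auto simp: edges_between_def)
    qed
    then have "C = {e \<in> edges ?G. v \<in> e}" unfolding C by (auto simp: edges_between_def)
    then show False using nontriv cut v by (auto simp: trivial_edge_cut_def)
  qed
  have two: "2 \<le> card W" if "W = X \<or> W = ?V - X" for W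
  proof -
    have "finite W" "W \<noteq> {}" using that X finV finite_subset by auto
    then have "card W \<noteq> 0" by simp
    moreover have "card W \<noteq> 1" using not_single[OF that] by (auto simp: card_1_singleton_iff)
    ultimately show ?thesis by linarith
  qed
  have "?E \<noteq> {}"
  proof
    assume "?E = {}"
    then have "b \<in> X" if "a \<in> X" "closed_segment a b edge_of P" for a b
      using that segment_edge_of_vertices(2)[OF that(2)] by (auto simp: cut_pairs_def)
    then show False using polytope_vertices_connected[OF P sides(1) X(1)] X(2) by blast
  qed
  then obtain a b where ab: "(a, b) \<in> ?E" by auto
  note degree_sum = cut_pairs_degree_sum[OF assms(2,3,1)]
  \<comment> \<open>The fibres at \<open>a\<close> and \<open>b\<close> share only the edge
    \<open>(a, b)\<close>, so their sizes add up to at most \<open>card C + 1\<close>.\<close>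
  have "d \<le> card C" using degree_sum[OF ab] card_fibres_le[OF finE ab] CE by linarith
  moreover have "card C \<le> card X"
    using cut_size_le_side[OF P sides(1)] two deg sides CE by auto
  moreover have "card (cut_pairs P (?V - X)) = card C"
    using cut_pairs_compl[OF sides(1)] CE by simp
  then have "card C \<le> card (?V - X)"
    using cut_size_le_side[OF P sides(2)] two deg by auto
  ultimately have "d * (d + 1) \<le> 2 * card C"
    using degree_sum CE card_ge_of_cover_and_degree_sum
      [OF finE cut_pairs_cover[OF P assms(3) sides(1)], of "d + 1"]
    by auto
  \<comment> \<open>Since \<open>d \<ge> 3\<close>, the subtraction in \<open>4 * d - 7\<close> is
    not truncated.\<close>
  then have "d * (d + 1) + 14 \<le> 8 * d" using assms(1,5) by linarith
  then have "int (d * (d + 1) + 14) \<le> int (8 * d)" by (rule of_nat_mono)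
  \<comment> \<open>Four times the inequality \<open>d * d - 7 * d + 14 \<le> 0\<close>, with the
    square completed.\<close>
  then have "(2 * int d - 7)\<^sup>2 + 7 \<le> 0" by (simp add: power2_eq_square algebra_simps)
  then show False using zero_le_power2[of "2 * int d - 7"] by linarith
qed

end
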